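(* Let $\mathbf{y}=\mathbf{A}\mathbf{x}_B+\mathbf{e}$, where $\mathbf{A}\in\mathbb{R}^{m\times n}$, $\mathbf{x}_B\in\mathbb{R}^n$ is block $K$-sparse with block support $T$, and $\|\mathbf{e}\|_2\le\varepsilon$. Suppose that $\mathbf{A}$ satisfies the block RIP of order $K+1$ with block RIP constant $$\delta^B_{K+1}<\frac{1}{\sqrt{K+1}}.$$ Then the BOMP algorithm applied to $(\mathbf{A},\mathbf{y})$ with the stopping criterion $\|\mathbf{r}^k\|_2\le\varepsilon$ exactly recovers $T$ in $K$ iterations, provided that $$\min_{i\in T}\|\mathbf{x}_B[i]\|_2>\frac{\varepsilon}{\sqrt{1-\delta^B_{K+1}}}+\frac{\varepsilon\sqrt{1+\delta^B_{K+1}}}{1-\sqrt{K+1}\,\delta^B_{K+1}}.$$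
   Context: Blocks. Fix positive integers $d, M, m, K$ and put $n=Md$, $\Omega=\{1,\dots,M\}$. A vector $\mathbf{x}_B\in\mathbb{R}^n$ is viewed as a concatenation of consecutive blocks $\mathbf{x}_B[1],\dots,\mathbf{x}_B[M]\in\mathbb{R}^d$, and $\mathbf{A}\in\mathbb{R}^{m\times n}$ as a concatenation of column-blocks $\mathbf{A}[1],\dots,\mathbf{A}[M]\in\mathbb{R}^{m\times d}$. The block support is $\mathrm{supp}^B(\mathbf{x}_B)=\{\ell\in\Omega:\mathbf{x}_B[\ell]\ne\mathbf{0}\}$, and $\mathbf{x}_B$ is block $K$-sparse if $|\mathrm{supp}^B(\mathbf{x}_B)|\le K$. A minimum over an empty index set is $+\infty$. A prime denotes transpose. Block RIP. $\mathbf{A}$ satisfies the block RIP of order $K$ with parameter $\delta\in(0,1)$ if $(1-\delta)\|\mathbf{h}\|_2^2\le\|\mathbf{A}\mathbf{h}\|_2^2\le(1+\delta)\|\mathbf{h}\|_2^2$ for every block $K$-sparse $\mathbf{h}\in\mathbb{R}^n$; the block RIP constant $\delta_K^B$ of order $K$ is the minimum (infimum) of such $\delta$. BOMP algorithm. Initialize $\mathbf{r}^0=\mathbf{y}$, $\Lambda^0=\emptyset$. For $k=1,2,\dots$, as long as the stopping criterion is not met by the current residual $\mathbf{r}^{k-1}$, perform the $k$-th iteration: choose $\lambda_k\in\arg\max_{\ell\in\Omega}\|\mathbf{A}'[\ell]\mathbf{r}^{k-1}\|_2$ (any maximizer); set $\Lambda^k=\Lambda^{k-1}\cup\{\lambda_k\}$;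 let $\mathbf{x}_B^k$ be a minimizer of $\|\mathbf{y}-\mathbf{A}\mathbf{z}\|_2$ over $\mathbf{z}\in\mathbb{R}^n$ with $\mathrm{supp}^B(\mathbf{z})\subseteq\Lambda^k$; set $\mathbf{r}^k=\mathbf{y}-\mathbf{A}\mathbf{x}_B^k$. When the criterion is met, output the current $\mathbf{x}_B^k$ and $\Lambda^k$. "Exactly recovers $T$ in $K$ iterations" means that the algorithm stops after at most $K$ iterations and its output index set equals $T$ (so exactly $K$ iterations are performed when $|T|=K$). *)

theory Defs
  imports "HOL-Analysis.Analysis"
begin

text \<open>
  Coordinates of \<open>\<real>\<^sup>n\<close> with \<open>n = M d\<close> are indexed by pairs: \<open>M = CARD('b)\<close>, \<open>d = CARD('d)\<close>, and
  the pair \<open>(l, j)\<close> is the \<open>j\<close>-th coordinate inside the \<open>l\<close>-th block. Thus \<open>\<Omega>\<close> is \<open>UNIV :: 'b set\<close>.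
\<close>

definition block :: "real ^ ('b::finite \<times> 'd::finite) \<Rightarrow> 'b \<Rightarrow> real ^ 'd" where
  "block x l = (\<chi> j. x $ (l, j))"

definition col_block :: "real ^ ('b::finite \<times> 'd::finite) ^ 'm::finite \<Rightarrow> 'b \<Rightarrow> real ^ 'd ^ 'm" where
  "col_block A l = (\<chi> i j. A $ i $ (l, j))"

definition block_supp :: "real ^ ('b::finite \<times> 'd::finite) \<Rightarrow> 'b set" where
  "block_supp x = {l. block x l \<noteq> 0}"

definition block_sparse :: "nat \<Rightarrow> real ^ ('b::finite \<times> 'd::finite) \<Rightarrow> bool" where
  "block_sparse K x \<longleftrightarrow> card (block_supp x) \<le> K"

definition block_RIP :: "nat \<Rightarrow> real ^ ('b::finite \<times> 'd::finite) ^ 'm::finite \<Rightarrow> real \<Rightarrow> bool" where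
  "block_RIP K A \<delta> \<longleftrightarrow> 0 < \<delta> \<and> \<delta> < 1 \<and>
     (\<forall>h. block_sparse K h \<longrightarrow>
        (1 - \<delta>) * (norm h)\<^sup>2 \<le> (norm (A *v h))\<^sup>2 \<and>
        (norm (A *v h))\<^sup>2 \<le> (1 + \<delta>) * (norm h)\<^sup>2)"

text \<open>Meaningful only if \<open>block_RIP K A \<delta>\<close> holds for some \<open>\<delta>\<close>: \<open>Inf {}\<close> is unspecified.\<close>

definition block_RIC :: "nat \<Rightarrow> real ^ ('b::finite \<times> 'd::finite) ^ 'm::finite \<Rightarrow> real" where
  "block_RIC K A = Inf {\<delta>. block_RIP K A \<delta>}"

text \<open>
  The sequences \<open>lam\<close>, \<open>Lam\<close>, \<open>xs\<close>, \<open>r\<close> (chosen indices, index sets, iterates, residuals) form a run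
  of BOMP. Iteration \<open>k + 1\<close> takes place, and hence constrains them, only if the stopping
  criterion fails for all of \<open>r 0, \<dots>, r k\<close>; the values after the first stop are irrelevant.
  The choices of maximizer and minimizer are arbitrary.
\<close>

definition bomp_run ::
  "real ^ ('b::finite \<times> 'd::finite) ^ 'm::finite \<Rightarrow> real ^ 'm \<Rightarrow> (real ^ 'm \<Rightarrow> bool) \<Rightarrow>
   (nat \<Rightarrow> 'b) \<Rightarrow> (nat \<Rightarrow> 'b set) \<Rightarrow> (nat \<Rightarrow> real ^ ('b \<times> 'd)) \<Rightarrow> (nat \<Rightarrow> real ^ 'm) \<Rightarrow> bool" where
  "bomp_run A y stop lam Lam xs r \<longleftrightarrow>
     r 0 = y \<and> Lam 0 = {} \<and>
     (\<forall>k. (\<forall>j\<le>k. \<not> stop (r j)) \<longrightarrow>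
        is_arg_max (\<lambda>l. norm (transpose (col_block A l) *v r k)) (\<lambda>l. l \<in> UNIV) (lam (Suc k)) \<and>
        Lam (Suc k) = Lam k \<union> {lam (Suc k)} \<and>
        is_arg_min (\<lambda>z. norm (y - A *v z)) (\<lambda>z. block_supp z \<subseteq> Lam (Suc k)) (xs (Suc k)) \<and>
        r (Suc k) = y - A *v xs (Suc k))"

text \<open>Every run stops, after at most \<open>K\<close> iterations, with output index set \<open>T\<close>.\<close>

definition bomp_exactly_recovers ::
  "real ^ ('b::finite \<times> 'd::finite) ^ 'm::finite \<Rightarrow> real ^ 'm \<Rightarrow> (real ^ 'm \<Rightarrow> bool) \<Rightarrow>
   'b set \<Rightarrow> nat \<Rightarrow> bool" where
  "bomp_exactly_recovers A y stop T K \<longleftrightarrow>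
     (\<forall>lam Lam xs r. bomp_run A y stop lam Lam xs r \<longrightarrow>
        (\<exists>k\<le>K. (\<forall>j<k. \<not> stop (r j)) \<and> stop (r k) \<and> Lam k = T))"

text \<open>
  Maximizers and minimizers always exist, so runs exist and the quantification over runs in
  \<open>bomp_exactly_recovers\<close> is never vacuous.
\<close>

lemma block_least_squares_exists:
  fixes A :: "real ^ ('b::finite \<times> 'd::finite) ^ 'm::finite"
  shows "\<exists>z. is_arg_min (\<lambda>z. norm (y - A *v z)) (\<lambda>z. block_supp z \<subseteq> L) z"
proof -
  define V where "V = {z :: real ^ ('b \<times> 'd). block_supp z \<subseteq> L}"
  have V: "V = {z. \<forall>l j. l \<notin> L \<longrightarrow> z $ (l, j) = 0}"
    by (auto simp: V_def block_supp_def block_def vec_eq_iff)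
  have "subspace V"
    unfolding V subspace_def by auto
  then have "subspace ((*v) A ` V)"
    by (intro linear_subspace_image matrix_vector_mul_linear)
  then have "closed ((*v) A ` V)" "(*v) A ` V \<noteq> {}"
    using closed_subspace subspace_0 by blast+
  then obtain w where w: "w \<in> (*v) A ` V" "\<forall>v\<in>(*v) A ` V. dist y w \<le> dist y v"
    using distance_attains_inf by metis
  then obtain z where "z \<in> V" "w = A *v z" by blast
  with w show ?thesis
    by (intro exI[of _ z]) (auto simp: is_arg_min_linorder V_def dist_norm)
qed

lemma bomp_run_exists:
  fixes A :: "real ^ ('b::finite \<times> 'd::finite) ^ 'm::finite"
  shows "\<exists>lam Lam xs r. bomp_run A y stop lam Lam xs r"
proof -
  define P where "P = (\<lambda>r. \<lambda>l. is_arg_max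
    (\<lambda>l. norm (transpose (col_block A l) *v r)) (\<lambda>l. l \<in> UNIV) l)"
  define Q where "Q = (\<lambda>L z. is_arg_min (\<lambda>z. norm (y - A *v z)) (\<lambda>z. block_supp z \<subseteq> L) z)"
  have P: "\<exists>l. P r l" for r
  proof -
    define f where "f = (\<lambda>l. norm (transpose (col_block A l) *v r))"
    have "Max (range f) \<in> range f" by (intro Max_in) auto
    then obtain l where "f l = Max (range f)" by force
    then have "\<forall>l'. f l' \<le> f l" by simp
    then show ?thesis
      unfolding P_def f_def by (intro exI[of _ l]) (simp add: is_arg_max_linorder)
  qed
  have Q: "\<exists>z. Q L z" for L
    unfolding Q_def by (rule block_least_squares_exists)
  define R where "R = (\<lambda>(l :: 'b, L, z :: real ^ ('b \<times> 'd), r) (l', L', z', r').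
    P r l' \<and> L' = L \<union> {l'} \<and> Q L' z' \<and> r' = y - A *v z')"
  have step: "\<exists>t. R s t" for s :: "'b \<times> 'b set \<times> (real ^ ('b \<times> 'd)) \<times> (real ^ 'm)"
  proof -
    obtain l L z r where s: "s = (l, L, z, r)" by (metis surj_pair)
    obtain l' where "P r l'" using P by blast
    moreover obtain z' where "Q (L \<union> {l'}) z'" using Q by blast
    ultimately show ?thesis
      unfolding R_def s by (intro exI[of _ "(l', L \<union> {l'}, z', y - A *v z')"]) simp
  qed
  define s where "s = rec_nat (undefined, {}, 0, y) (\<lambda>_ u. SOME t. R u t)"
  have s0: "s 0 = (undefined, {}, 0, y)" by (simp add: s_def)
  have sR: "R (s k) (s (Suc k))" for k
    using someI_ex[OF step[of "s k"]] by (simp add: s_def)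
  have "bomp_run A y stop (\<lambda>k. fst (s k)) (\<lambda>k. fst (snd (s k)))
      (\<lambda>k. fst (snd (snd (s k)))) (\<lambda>k. snd (snd (snd (s k))))"
    using sR unfolding bomp_run_def R_def P_def Q_def case_prod_beta
    by (intro conjI allI impI) (simp only: s0 fst_conv snd_conv, simp only: s0 fst_conv snd_conv, blast+)
  then show ?thesis by blast
qed

end

theory Submission
  imports Defs
begin

text \<open>
  Replace the true signal \<open>x\<close> by the least squares solution \<open>w\<close> over vectors supported on \<open>T\<close>. Then
  \<open>y = A w + f\<close>, where \<open>f\<close> is orthogonal to the column blocks in \<open>T\<close> and \<open>\<parallel>f\<parallel> \<le> \<epsilon>\<close>; this costs at most
  \<open>\<epsilon> / \<surd>(1 - \<delta>)\<close> in each block, which is the first term of the lower bound on the blocks of \<open>x\<close>.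

  Let \<open>L \<subset> T\<close> be the current index set, \<open>z\<close> the current iterate, \<open>h = w - z\<close> and \<open>r = A h + f\<close> the
  residual. As \<open>r\<close> is orthogonal to the blocks in \<open>L\<close>, \<open>\<parallel>A h\<parallel>\<^sup>2 = \<langle>A h, r\<rangle> \<le> t \<beta>\<close> with
  \<open>t = (\<Sum>i\<in>T - L. \<parallel>w[i]\<parallel>)\<close> and \<open>\<beta> = max \<parallel>A'[i] r\<parallel>\<close>. If a maximizer \<open>l\<close> were outside \<open>T\<close>, then with a
  unit vector \<open>u\<close> in block \<open>l\<close> we would have \<open>\<beta> = \<langle>A u, r\<rangle>\<close>, hence
  \<open>\<langle>A (h - t u), A h\<rangle> \<le> t \<langle>A u, f\<rangle> \<le> t \<epsilon> \<surd>(1 + \<delta>)\<close>. The restricted isometry property bounds the left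
  side below by \<open>\<parallel>h\<parallel>\<^sup>2 - \<delta> \<parallel>h\<parallel> \<surd>(\<parallel>h\<parallel>\<^sup>2 + t\<^sup>2)\<close>, and \<open>t\<^sup>2 \<le> K \<parallel>h\<parallel>\<^sup>2\<close> then contradicts the second
  term of the lower bound.
\<close>

section \<open>Block arithmetic and the adjoint\<close>

lemma block_diff: "block (x - y) l = block x l - block y l"
  by (simp add: block_def vec_eq_iff)

lemma block_add: "block (x + y) l = block x l + block y l"
  by (simp add: block_def vec_eq_iff)

lemma block_scaleR: "block (c *\<^sub>R x) l = c *\<^sub>R block x l"
  by (simp add: block_def vec_eq_iff)

lemma block_zero [simp]: "block 0 l = 0"
  by (simp add: block_def vec_eq_iff)

lemma block_supp_zero [simp]: "block_supp 0 = {}"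
  by (simp add: block_supp_def)

lemma block_supp_diff: "block_supp (x - y) \<subseteq> block_supp x \<union> block_supp y"
  by (auto simp: block_supp_def block_diff)

lemma block_supp_add: "block_supp (x + y) \<subseteq> block_supp x \<union> block_supp y"
  by (auto simp: block_supp_def block_add)

lemma block_supp_scaleR: "block_supp (c *\<^sub>R x) \<subseteq> block_supp x"
  by (auto simp: block_supp_def block_scaleR)

lemma block_sparse_subset:
  fixes x :: "real ^ ('b::finite \<times> 'd::finite)"
  assumes "block_supp x \<subseteq> S" "card S \<le> K"
  shows "block_sparse K x"
  using card_mono[OF finite assms(1)] assms(2) by (simp add: block_sparse_def)

lemma inner_blocks:
  fixes x y :: "real ^ ('b::finite \<times> 'd::finite)"
  shows "x \<bullet> y = (\<Sum>l\<in>UNIV. block x l \<bullet> block y l)"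
  by (simp add: inner_vec_def block_def sum.cartesian_product flip: UNIV_Times_UNIV)

lemma norm_blocks:
  fixes x :: "real ^ ('b::finite \<times> 'd::finite)"
  shows "(norm x)\<^sup>2 = (\<Sum>l\<in>UNIV. (norm (block x l))\<^sup>2)"
  by (simp add: power2_norm_eq_inner inner_blocks)

lemma norm_block_le:
  fixes x :: "real ^ ('b::finite \<times> 'd::finite)"
  shows "norm (block x l) \<le> norm x"
proof (rule power2_le_imp_le)
  show "(norm (block x l))\<^sup>2 \<le> (norm x)\<^sup>2"
    unfolding norm_blocks[of x] by (rule member_le_sum) auto
qed simp

lemma block_transpose_mult:
  "block (transpose A *v r) l = transpose (col_block A l) *v r"
  by (simp add: block_def col_block_def transpose_def matrix_vector_mult_def vec_eq_iff)

lemma inner_mult_blocks: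
  fixes A :: "real ^ ('b::finite \<times> 'd::finite) ^ 'm::finite"
  shows "(A *v h) \<bullet> r = (\<Sum>l\<in>UNIV. block h l \<bullet> (transpose (col_block A l) *v r))"
proof -
  have "(A *v h) \<bullet> r = h \<bullet> (transpose A *v r)"
    by (metis dot_lmul_matrix inner_commute transpose_matrix_vector)
  then show ?thesis
    by (simp only: inner_blocks block_transpose_mult)
qed

definition embed_block :: "'b \<Rightarrow> real ^ 'd \<Rightarrow> real ^ ('b::finite \<times> 'd::finite)" where
  "embed_block l v = (\<chi> p. if fst p = l then v $ snd p else 0)"

lemma block_embed: "block (embed_block l v) i = (if i = l then v else 0)"
  by (simp add: block_def embed_block_def vec_eq_iff)

lemma block_supp_embed: "block_supp (embed_block l v) \<subseteq> {l}"
  by (auto simp: block_supp_def block_embed)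

lemma norm_embed: "norm (embed_block l v) = norm v"
proof -
  have "(norm (embed_block l v))\<^sup>2 = (norm v)\<^sup>2"
    by (simp add: norm_blocks block_embed if_distrib[of "\<lambda>z. (norm z)\<^sup>2"] cong: if_cong)
  then show ?thesis by simp
qed

text \<open>Test vectors for correlations: taking \<open>v\<close> to be the correlation itself
  yields its squared norm, and taking its \<open>sgn\<close> yields its norm.\<close>

lemma inner_mult_embed:
  "(A *v embed_block l v) \<bullet> r = v \<bullet> (transpose (col_block A l) *v r)"
  by (simp add: inner_mult_blocks block_embed if_distrib[of "\<lambda>z. z \<bullet> _"] cong: if_cong)

section \<open>Least squares and restricted isometry\<close>

text \<open>First-order optimality: a step along the feasible direction \<open>w\<close>, of the
  length \<open>s\<close> that is best for the quadratic in \<open>s\<close>, would lower the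
  squared residual by \<open>(v \<bullet> r)\<^sup>2 / (v \<bullet> v)\<close>.\<close>

lemma least_squares_orthogonal:
  assumes min: "is_arg_min (\<lambda>z. norm (y - A *v z)) (\<lambda>z. block_supp z \<subseteq> L) z"
    and w: "block_supp w \<subseteq> L"
  shows "(A *v w) \<bullet> (y - A *v z) = 0"
proof (cases "A *v w = 0")
  case False
  define r where "r = y - A *v z"
  define v where "v = A *v w"
  define s where "s = (v \<bullet> r) / (v \<bullet> v)"
  have v: "v \<bullet> v > 0" using False by (simp add: v_def)
  have "block_supp (z + s *\<^sub>R w) \<subseteq> L"
    using block_supp_add[of z "s *\<^sub>R w"] block_supp_scaleR[of s w] w min
    by (auto simp: is_arg_min_linorder)
  then have "norm (y - A *v z) \<le> norm (y - A *v (z + s *\<^sub>R w))"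
    using min by (auto simp: is_arg_min_linorder)
  also have "y - A *v (z + s *\<^sub>R w) = r - s *\<^sub>R v"
    by (simp add: r_def v_def matrix_vector_right_distrib matrix_vector_mult_scaleR)
  finally have "(norm r)\<^sup>2 \<le> (norm (r - s *\<^sub>R v))\<^sup>2"
    by (simp add: r_def)
  also have "\<dots> = (norm r)\<^sup>2 - 2 * s * (v \<bullet> r) + s * (s * (v \<bullet> v))"
    unfolding power2_norm_eq_inner
    by (simp add: inner_diff_left inner_diff_right inner_commute algebra_simps)
  also have "s * (v \<bullet> v) = v \<bullet> r" using v by (simp add: s_def)
  finally have "s * (v \<bullet> r) \<le> 0" by simp
  then have "(v \<bullet> r)\<^sup>2 \<le> 0"
    using v by (simp add: s_def power2_eq_square divide_le_0_iff)
  then show ?thesis by (simp add: r_def v_def)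
qed simp

lemma block_RIC_nonneg:
  assumes "\<exists>\<delta>'. block_RIP K A \<delta>'"
  shows "0 \<le> block_RIC K A"
  unfolding block_RIC_def using assms
  by (intro cInf_greatest) (auto simp: block_RIP_def)

text \<open>For fixed \<open>h\<close> both inequalities say that
  \<open>\<bar>q - 1\<bar> \<le> \<delta>\<close> for the quotient \<open>q\<close> of squared
  norms, a bound that passes to the infimum. \<open>block_RIP\<close> itself may fail there, since
  the infimum can be 0.\<close>

lemma block_RIC_bounds:
  assumes ex: "\<exists>\<delta>'. block_RIP K A \<delta>'" and h: "block_sparse K h"
  shows "(1 - block_RIC K A) * (norm h)\<^sup>2 \<le> (norm (A *v h))\<^sup>2"
    and "(norm (A *v h))\<^sup>2 \<le> (1 + block_RIC K A) * (norm h)\<^sup>2"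
proof -
  have "(1 - block_RIC K A) * (norm h)\<^sup>2 \<le> (norm (A *v h))\<^sup>2 \<and>
        (norm (A *v h))\<^sup>2 \<le> (1 + block_RIC K A) * (norm h)\<^sup>2"
  proof (cases "h = 0")
    case False
    define q where "q = (norm (A *v h))\<^sup>2 / (norm h)\<^sup>2"
    have "\<bar>q - 1\<bar> \<le> \<delta>" if "block_RIP K A \<delta>" for \<delta>
      using that h False by (auto simp: block_RIP_def q_def abs_le_iff field_simps)
    then have "\<bar>q - 1\<bar> \<le> block_RIC K A"
      unfolding block_RIC_def using ex by (intro cInf_greatest) auto
    then show ?thesis
      using False by (auto simp: q_def abs_le_iff field_simps)
  qed simp
  then show "(1 - block_RIC K A) * (norm h)\<^sup>2 \<le> (norm (A *v h))\<^sup>2"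
    and "(norm (A *v h))\<^sup>2 \<le> (1 + block_RIC K A) * (norm h)\<^sup>2" by auto
qed

text \<open>Polarization: subtract the upper bound for a difference of multiples of \<open>p\<close>
  and \<open>q\<close> from the lower bound for their sum.\<close>

lemma RIP_inner_lower:
  fixes p q :: "real ^ 'n::finite" and A :: "real ^ 'n ^ 'm::finite"
  assumes lower: "\<And>a b. (1 - \<delta>) * (norm (a *\<^sub>R p + b *\<^sub>R q))\<^sup>2 \<le> (norm (A *v (a *\<^sub>R p + b *\<^sub>R q)))\<^sup>2"
    and upper: "\<And>a b. (norm (A *v (a *\<^sub>R p + b *\<^sub>R q)))\<^sup>2 \<le> (1 + \<delta>) * (norm (a *\<^sub>R p + b *\<^sub>R q))\<^sup>2"
  shows "p \<bullet> q - \<delta> * norm p * norm q \<le> (A *v p) \<bullet> (A *v q)"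
proof (cases "p = 0 \<or> q = 0")
  case False
  \<comment> \<open>Crossed weights give both scaled vectors the norm \<open>a * b\<close>, so the
    total loss is \<open>4 * \<delta> * (a * b)\<^sup>2\<close>, which becomes
    \<open>\<delta> * norm p * norm q\<close> after division by \<open>4 * (a * b)\<close>.\<close>
  define a where "a = norm q"
  define b where "b = norm p"
  have pos: "a > 0" "b > 0" using False by (auto simp: a_def b_def)
  have sq: "p \<bullet> p = b\<^sup>2" "q \<bullet> q = a\<^sup>2" by (simp_all add: a_def b_def power2_norm_eq_inner)
  have expand: "(norm (a *\<^sub>R v + c *\<^sub>R w))\<^sup>2 = a\<^sup>2 * (v \<bullet> v) + 2 * (a * c) * (v \<bullet> w) + c\<^sup>2 * (w \<bullet> w)"
    for c and v w :: "real ^ 'k::finite"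
    unfolding power2_norm_eq_inner
    by (simp add: inner_add_left inner_add_right inner_commute algebra_simps power2_eq_square)
  have mult: "A *v (a *\<^sub>R p + c *\<^sub>R q) = a *\<^sub>R (A *v p) + c *\<^sub>R (A *v q)" for c
    by (simp add: matrix_vector_right_distrib matrix_vector_mult_scaleR)
  have 1: "(1 - \<delta>) * (a\<^sup>2 * b\<^sup>2 + 2 * (a * b) * (p \<bullet> q) + b\<^sup>2 * a\<^sup>2)
     \<le> a\<^sup>2 * ((A *v p) \<bullet> (A *v p)) + 2 * (a * b) * ((A *v p) \<bullet> (A *v q)) + b\<^sup>2 * ((A *v q) \<bullet> (A *v q))"
    using lower[of a b] unfolding mult expand sq by simp
  have 2: "a\<^sup>2 * ((A *v p) \<bullet> (A *v p)) - 2 * (a * b) * ((A *v p) \<bullet> (A *v q)) + b\<^sup>2 * ((A *v q) \<bullet> (A *v q))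
     \<le> (1 + \<delta>) * (a\<^sup>2 * b\<^sup>2 - 2 * (a * b) * (p \<bullet> q) + b\<^sup>2 * a\<^sup>2)"
    using upper[of a "- b"] unfolding mult expand sq by simp
  have "(4 * (a * b)) * (p \<bullet> q - \<delta> * b * a) \<le> (4 * (a * b)) * ((A *v p) \<bullet> (A *v q))"
    using 1 2 by (simp add: algebra_simps power2_eq_square)
  then show ?thesis using pos by (simp add: a_def b_def)
qed auto

section \<open>One iteration from a proper subset of the support\<close>

context
  fixes A :: "real ^ ('b::finite \<times> 'd::finite) ^ 'm::finite" and K :: nat and \<delta> \<epsilon> :: real
    and w :: "real ^ ('b \<times> 'd)" and y :: "real ^ 'm" and T :: "'b set"
  assumes RIP_lower: "\<And>h. block_sparse (K + 1) h \<Longrightarrow> (1 - \<delta>) * (norm h)\<^sup>2 \<le> (norm (A *v h))\<^sup>2"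
    and RIP_upper: "\<And>h. block_sparse (K + 1) h \<Longrightarrow> (norm (A *v h))\<^sup>2 \<le> (1 + \<delta>) * (norm h)\<^sup>2"
    and delta: "0 \<le> \<delta>" "sqrt (real (K + 1)) * \<delta> < 1"
    and card_T: "card T \<le> K"
    and w_min: "is_arg_min (\<lambda>z. norm (y - A *v z)) (\<lambda>z. block_supp z \<subseteq> T) w"
    and noise: "norm (y - A *v w) \<le> \<epsilon>"
    and w_large: "\<And>i. i \<in> T \<Longrightarrow>
      \<epsilon> * sqrt (1 + \<delta>) / (1 - sqrt (real (K + 1)) * \<delta>) < norm (block w i)"
begin

lemma delta_less_1: "\<delta> < 1"
proof -
  have "1 * \<delta> \<le> sqrt (real (K + 1)) * \<delta>" by (rule mult_right_mono) (use delta in auto)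
  then show ?thesis using delta by simp
qed

lemma eps_nonneg: "0 \<le> \<epsilon>"
  using noise norm_ge_zero order_trans by blast

context
  fixes L :: "'b set" and z :: "real ^ ('b \<times> 'd)" and r :: "real ^ 'm"
  assumes L: "L \<subset> T"
    and z_min: "is_arg_min (\<lambda>z. norm (y - A *v z)) (\<lambda>z. block_supp z \<subseteq> L) z"
    and r: "r = y - A *v z"
begin

lemma error_supp: "block_supp (w - z) \<subseteq> T"
proof -
  have "block_supp w \<subseteq> T" "block_supp z \<subseteq> L"
    using w_min z_min by (auto simp: is_arg_min_linorder)
  then show ?thesis using L block_supp_diff[of w z] by blast
qed

lemma block_z_eq_0: "i \<notin> L \<Longrightarrow> block z i = 0"
  using z_min by (auto simp: is_arg_min_linorder block_supp_def)

lemma residual_split: "r = A *v (w - z) + (y - A *v w)"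
  by (simp add: r matrix_vector_mult_diff_distrib)

lemma signal_orthogonal_noise: "block_supp v \<subseteq> T \<Longrightarrow> (A *v v) \<bullet> (y - A *v w) = 0"
  by (rule least_squares_orthogonal[OF w_min])

lemma inner_error_residual: "(A *v (w - z)) \<bullet> r = (norm (A *v (w - z)))\<^sup>2"
  using signal_orthogonal_noise[OF error_supp]
  by (simp add: residual_split inner_add_right power2_norm_eq_inner)

lemma error_RIP_lower: "(1 - \<delta>) * (norm (w - z))\<^sup>2 \<le> (norm (A *v (w - z)))\<^sup>2"
  using card_T by (intro RIP_lower block_sparse_subset[OF error_supp]) auto

lemma error_block_large:
  "i \<in> T - L \<Longrightarrow> \<epsilon> * sqrt (1 + \<delta>) / (1 - sqrt (real (K + 1)) * \<delta>) < norm (block (w - z) i)"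
  using w_large by (simp add: block_diff block_z_eq_0)

lemma error_nonzero: "0 < norm (w - z)"
proof -
  obtain i where "i \<in> T - L" using L by blast
  then have "\<epsilon> * sqrt (1 + \<delta>) / (1 - sqrt (real (K + 1)) * \<delta>) < norm (w - z)"
    using error_block_large norm_block_le less_le_trans by blast
  moreover have "0 \<le> \<epsilon> * sqrt (1 + \<delta>) / (1 - sqrt (real (K + 1)) * \<delta>)"
    using delta eps_nonneg by simp
  ultimately show ?thesis by linarith
qed

text \<open>Hence the algorithm cannot stop before it has found all of \<open>T\<close>. A missed
  block makes \<open>w - z\<close> large, RIP transfers this to \<open>A *v (w - z)\<close>, and
  adding the orthogonal noise only increases the norm. The constants fit because \<open>D \<le> 1 -
  \<delta> \<le> sqrt (1 - \<delta>) * sqrt (1 + \<delta>)\<close>.\<close>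

lemma residual_large: "\<epsilon> < norm r"
proof -
  define D where "D = 1 - sqrt (real (K + 1)) * \<delta>"
  have D: "0 < D" using delta by (simp add: D_def)
  have "1 * \<delta> \<le> sqrt (real (K + 1)) * \<delta>" by (rule mult_right_mono) (use delta in auto)
  then have "D \<le> 1 - \<delta>" by (simp add: D_def)
  also have "1 - \<delta> = sqrt (1 - \<delta>) * sqrt (1 - \<delta>)" using delta_less_1 by simp
  also have "\<dots> \<le> sqrt (1 - \<delta>) * sqrt (1 + \<delta>)"
    using delta delta_less_1 by (intro mult_left_mono) auto
  finally have "\<epsilon> * D \<le> \<epsilon> * (sqrt (1 - \<delta>) * sqrt (1 + \<delta>))"
    using eps_nonneg by (rule mult_left_mono)
  then have "\<epsilon> \<le> sqrt (1 - \<delta>) * (\<epsilon> * sqrt (1 + \<delta>) / D)"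
    using D by (simp add: field_simps)
  also obtain i where "i \<in> T - L" using L by blast
  then have "\<epsilon> * sqrt (1 + \<delta>) / D < norm (w - z)"
    unfolding D_def using error_block_large norm_block_le less_le_trans by blast
  then have "sqrt (1 - \<delta>) * (\<epsilon> * sqrt (1 + \<delta>) / D) < sqrt (1 - \<delta>) * norm (w - z)"
    using delta_less_1 by (intro mult_strict_left_mono) auto
  also have "\<dots> \<le> norm (A *v (w - z))"
    using real_sqrt_le_mono[OF error_RIP_lower] by (simp add: real_sqrt_mult)
  also have "\<dots> \<le> norm r"
  proof (rule power2_le_imp_le)
    have "(norm r)\<^sup>2 = (norm (A *v (w - z)))\<^sup>2 + (norm (y - A *v w))\<^sup>2"
      unfolding residual_split using signal_orthogonal_noise[OF error_supp]
      by (intro norm_add_Pythagorean) (simp add: orthogonal_def)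
    then show "(norm (A *v (w - z)))\<^sup>2 \<le> (norm r)\<^sup>2" by simp
  qed simp
  finally show ?thesis .
qed

lemma block_correlation_zero:
  assumes "i \<in> L"
  shows "transpose (col_block A i) *v r = 0"
proof -
  define v where "v = transpose (col_block A i) *v r"
  have "v \<bullet> v = (A *v embed_block i v) \<bullet> r"
    by (simp add: inner_mult_embed v_def)
  also have "\<dots> = 0"
    unfolding r by (rule least_squares_orthogonal[OF z_min]) (use block_supp_embed[of i v] assms in auto)
  finally show ?thesis by (simp add: v_def)
qed

text \<open>Blocks in \<open>L\<close> drop out by the normal equations and blocks outside
  \<open>T\<close> by the support of the error; Cauchy-Schwarz handles the rest.\<close>

lemma error_energy_le:
  assumes max: "\<And>i. norm (transpose (col_block A i) *v r) \<le> \<beta>"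
  shows "(norm (A *v (w - z)))\<^sup>2 \<le> (\<Sum>i\<in>T - L. norm (block (w - z) i)) * \<beta>"
proof -
  have zero: "block (w - z) i \<bullet> (transpose (col_block A i) *v r) = 0" if "i \<notin> T - L" for i
  proof (cases "i \<in> L")
    case False
    then have "block (w - z) i = 0"
      using that error_supp by (auto simp: block_supp_def)
    then show ?thesis by simp
  qed (simp only: block_correlation_zero inner_zero_right)
  have "(norm (A *v (w - z)))\<^sup>2 = (\<Sum>i\<in>UNIV. block (w - z) i \<bullet> (transpose (col_block A i) *v r))"
    by (simp flip: inner_error_residual add: inner_mult_blocks)
  also have "\<dots> = (\<Sum>i\<in>T - L. block (w - z) i \<bullet> (transpose (col_block A i) *v r))"
    using zero by (intro sum.mono_neutral_right) auto
  also have "\<dots> \<le> (\<Sum>i\<in>T - L. norm (block (w - z) i) * \<beta>)"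
    using max by (intro sum_mono order_trans[OF norm_cauchy_schwarz] mult_left_mono) auto
  finally show ?thesis by (simp add: sum_distrib_right)
qed

text \<open>The factor \<open>card (T - L)\<close> is not yet bounded by \<open>K\<close>: it
  cancels when the first two bounds are combined in \<open>maximizer_in_T\<close>.\<close>

lemma mixed_norm_bounds:
  defines "t \<equiv> \<Sum>i\<in>T - L. norm (block (w - z) i)"
  shows "t\<^sup>2 \<le> card (T - L) * (norm (w - z))\<^sup>2"
    and "card (T - L) * (\<epsilon> * sqrt (1 + \<delta>) / (1 - sqrt (real (K + 1)) * \<delta>)) < t"
    and "0 < t"
proof -
  have "t\<^sup>2 \<le> card (T - L) * (\<Sum>i\<in>T - L. (norm (block (w - z) i))\<^sup>2)"
    using sum_squared_le_sum_of_squares[of "\<lambda>i. norm (block (w - z) i)" "T - L"]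
    unfolding t_def by (simp add: mult.commute)
  also have "\<dots> \<le> card (T - L) * (norm (w - z))\<^sup>2"
    unfolding norm_blocks[of "w - z"] by (intro mult_left_mono sum_mono2) auto
  finally show "t\<^sup>2 \<le> card (T - L) * (norm (w - z))\<^sup>2" .
  have "(\<Sum>i\<in>T - L. \<epsilon> * sqrt (1 + \<delta>) / (1 - sqrt (real (K + 1)) * \<delta>)) < t"
    unfolding t_def using L error_block_large by (intro sum_strict_mono) auto
  then show *: "card (T - L) * (\<epsilon> * sqrt (1 + \<delta>) / (1 - sqrt (real (K + 1)) * \<delta>)) < t" by simp
  have "0 \<le> card (T - L) * (\<epsilon> * sqrt (1 + \<delta>) / (1 - sqrt (real (K + 1)) * \<delta>))"
    using delta eps_nonneg by simp
  with * show "0 < t" by linarith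
qed

lemma maximizer_in_T:
  assumes max: "\<And>i. norm (transpose (col_block A i) *v r) \<le> norm (transpose (col_block A l) *v r)"
  shows "l \<in> T"
proof (rule ccontr)
  assume l: "l \<notin> T"
  define h where "h = w - z"
  define t where "t = (\<Sum>i\<in>T - L. norm (block (w - z) i))"
  define s where "s = real (card (T - L))"
  define D where "D = 1 - sqrt (real (K + 1)) * \<delta>"
  \<comment> \<open>If the correlation vanishes, \<open>sgn\<close> makes \<open>u\<close> zero;
    therefore only \<open>norm u \<le> 1\<close> is claimed below.\<close>
  define u where "u = embed_block l (sgn (transpose (col_block A l) *v r))"
  have D: "0 < D" using delta by (simp add: D_def)
  have t: "t\<^sup>2 \<le> s * (norm h)\<^sup>2" "s * (\<epsilon> * sqrt (1 + \<delta>) / D) < t" "0 < t"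
    using mixed_norm_bounds unfolding t_def s_def h_def D_def by auto
  have "card (T - L) \<le> card T" by (intro card_mono) auto
  then have sK: "s \<le> K" unfolding s_def using card_T by linarith
  have s: "0 < s" unfolding s_def using L by (auto simp: card_gt_0_iff)
  have u_supp: "block_supp u \<subseteq> {l}" unfolding u_def by (rule block_supp_embed)
  have u_norm: "norm u \<le> 1" by (simp add: u_def norm_embed norm_sgn)
  have h_supp: "block_supp h \<subseteq> T" unfolding h_def by (rule error_supp)
  have "block h l = 0" using h_supp l by (auto simp: block_supp_def)
  then have hu: "h \<bullet> u = 0"
    unfolding inner_blocks by (intro sum.neutral) (simp add: u_def block_embed)

  have comb_supp: "block_supp (a *\<^sub>R (h - t *\<^sub>R u) + b *\<^sub>R h) \<subseteq> insert l T" for a b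
    using h_supp u_supp block_supp_add[of "a *\<^sub>R (h - t *\<^sub>R u)" "b *\<^sub>R h"]
      block_supp_scaleR[of a "h - t *\<^sub>R u"] block_supp_scaleR[of b h]
      block_supp_diff[of h "t *\<^sub>R u"] block_supp_scaleR[of t u]
    by blast
  \<comment> \<open>The order \<open>K + 1\<close> is needed here: at most \<open>K\<close> blocks
    of \<open>T\<close> and the wrong block \<open>l\<close>.\<close>
  have comb: "block_sparse (K + 1) (a *\<^sub>R (h - t *\<^sub>R u) + b *\<^sub>R h)" for a b
    by (rule block_sparse_subset[OF comb_supp]) (use l card_T in simp)
  have "(h - t *\<^sub>R u) \<bullet> h - \<delta> * norm (h - t *\<^sub>R u) * norm h \<le> (A *v (h - t *\<^sub>R u)) \<bullet> (A *v h)"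
    by (rule RIP_inner_lower) (intro RIP_lower RIP_upper comb)+
  moreover have "(h - t *\<^sub>R u) \<bullet> h = (norm h)\<^sup>2"
    using hu by (simp add: inner_diff_left power2_norm_eq_inner inner_commute[of u])
  \<comment> \<open>Since \<open>h\<close> and \<open>u\<close> are orthogonal and
    \<open>t\<^sup>2 \<le> K * (norm h)\<^sup>2\<close>, Pythagoras produces the factor
    \<open>sqrt (K + 1)\<close>.\<close>
  moreover have "norm (h - t *\<^sub>R u) \<le> sqrt (real (K + 1)) * norm h"
  proof (rule power2_le_imp_le)
    have "(norm (h - t *\<^sub>R u))\<^sup>2 = (norm h)\<^sup>2 + t\<^sup>2 * (norm u)\<^sup>2"
      unfolding power2_norm_eq_inner using hu
      by (simp add: inner_diff_left inner_diff_right inner_commute power2_eq_square)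
    also have "\<dots> \<le> (norm h)\<^sup>2 + t\<^sup>2 * 1"
      using u_norm by (intro add_left_mono mult_left_mono) (auto simp: power_le_one)
    also have "\<dots> \<le> (norm h)\<^sup>2 + K * (norm h)\<^sup>2"
      using t(1) mult_right_mono[OF sK, of "(norm h)\<^sup>2"] by simp
    finally show "(norm (h - t *\<^sub>R u))\<^sup>2 \<le> (sqrt (real (K + 1)) * norm h)\<^sup>2"
      by (simp add: power_mult_distrib algebra_simps)
  qed simp
  then have "\<delta> * norm (h - t *\<^sub>R u) * norm h \<le> \<delta> * (sqrt (real (K + 1)) * norm h) * norm h"
    using delta by (intro mult_right_mono mult_left_mono) auto
  ultimately have lower: "D * (norm h)\<^sup>2 \<le> (A *v (h - t *\<^sub>R u)) \<bullet> (A *v h)"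
    by (simp add: D_def algebra_simps power2_eq_square)

  have "norm (transpose (col_block A l) *v r) = (A *v u) \<bullet> r"
    unfolding u_def inner_mult_embed
    by (simp add: sgn_div_norm dot_square_norm power2_eq_square divide_simps)
  then have "(norm (A *v h))\<^sup>2 \<le> t * ((A *v u) \<bullet> r)"
    using error_energy_le[OF max] by (simp add: h_def t_def)
  also have "r = A *v h + (y - A *v w)" unfolding h_def by (rule residual_split)
  finally have "(A *v (h - t *\<^sub>R u)) \<bullet> (A *v h) \<le> t * ((A *v u) \<bullet> (y - A *v w))"
    by (simp add: matrix_vector_mult_diff_distrib matrix_vector_mult_scaleR inner_diff_left
        inner_add_right power2_norm_eq_inner algebra_simps)
  also have "(A *v u) \<bullet> (y - A *v w) \<le> sqrt (1 + \<delta>) * \<epsilon>"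
  proof (rule order_trans[OF norm_cauchy_schwarz mult_mono])
    have "(norm (A *v u))\<^sup>2 \<le> (1 + \<delta>) * (norm u)\<^sup>2"
      by (rule RIP_upper, rule block_sparse_subset[OF u_supp]) simp
    also have "\<dots> \<le> (1 + \<delta>) * 1"
      using delta u_norm by (intro mult_left_mono) (auto simp: power_le_one)
    finally show "norm (A *v u) \<le> sqrt (1 + \<delta>)"
      using real_le_rsqrt by simp
  qed (use noise delta in auto)
  finally have "D * (norm h)\<^sup>2 \<le> t * (sqrt (1 + \<delta>) * \<epsilon>)"
    using lower t(3) by (simp add: mult_left_mono)
  \<comment> \<open>Multiplication by \<open>s\<close> lets
    \<open>t\<^sup>2 \<le> s * (norm h)\<^sup>2\<close> trade the energy of \<open>h\<close> for
    \<open>t\<^sup>2\<close>; cancelling \<open>t\<close> then contradicts the strict lower bound on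
    \<open>t\<close>.\<close>
  then have "s * (D * (norm h)\<^sup>2) \<le> s * (t * (sqrt (1 + \<delta>) * \<epsilon>))"
    using s by (intro mult_left_mono) auto
  moreover have "D * t\<^sup>2 \<le> D * (s * (norm h)\<^sup>2)"
    using t(1) D by (intro mult_left_mono) auto
  ultimately have "t * (D * t) \<le> t * (s * (sqrt (1 + \<delta>) * \<epsilon>))"
    by (simp add: algebra_simps power2_eq_square)
  then have "D * t \<le> s * (sqrt (1 + \<delta>) * \<epsilon>)"
    using t(3) by simp
  with t(2) D show False
    by (simp add: field_simps)
qed

text \<open>A maximizer in \<open>L\<close> would force all correlations to vanish, hence
  \<open>A *v (w - z) = 0\<close>, against RIP. So every iteration adds a new index.\<close>

lemma maximizer_not_in_L:
  assumes max: "\<And>i. norm (transpose (col_block A i) *v r) \<le> norm (transpose (col_block A l) *v r)"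
  shows "l \<notin> L"
proof
  assume "l \<in> L"
  then have "(norm (A *v (w - z)))\<^sup>2 \<le> 0"
    using error_energy_le[OF max] block_correlation_zero by simp
  then have "(1 - \<delta>) * (norm (w - z))\<^sup>2 \<le> 0"
    using error_RIP_lower by simp
  moreover have "0 < (1 - \<delta>) * (norm (w - z))\<^sup>2"
    using delta_less_1 error_nonzero by simp
  ultimately show False by simp
qed

end

section \<open>Induction along a run\<close>

lemma bomp_exactly_recovers_support: "bomp_exactly_recovers A y (\<lambda>r. norm r \<le> \<epsilon>) T K"
  unfolding bomp_exactly_recovers_def
proof (intro allI impI)
  fix lam Lam xs r
  assume run: "bomp_run A y (\<lambda>r. norm r \<le> \<epsilon>) lam Lam xs r"
  \<comment> \<open>The iterate is existentially quantified because \<open>bomp_run\<close> leaves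
    \<open>xs 0\<close> unconstrained; for \<open>k = 0\<close> the zero vector serves.\<close>
  have inv: "(\<forall>j<k. \<not> norm (r j) \<le> \<epsilon>) \<and> Lam k \<subseteq> T \<and> card (Lam k) = k \<and>
      (\<exists>z. is_arg_min (\<lambda>z. norm (y - A *v z)) (\<lambda>z. block_supp z \<subseteq> Lam k) z \<and> r k = y - A *v z)"
    if "k \<le> card T" for k
    using that
  proof (induction k)
    case 0
    have "z = 0" if "block_supp z = {}" for z :: "real ^ ('b \<times> 'd)"
      using that by (auto simp: block_supp_def block_def vec_eq_iff)
    then have "is_arg_min (\<lambda>z. norm (y - A *v z)) (\<lambda>z. block_supp z \<subseteq> {}) 0"
      by (fastforce simp: is_arg_min_linorder)
    then show ?case
      using run by (intro conjI exI[of _ 0]) (auto simp: bomp_run_def)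
  next
    case (Suc k)
    then obtain z where IH: "\<forall>j<k. \<not> norm (r j) \<le> \<epsilon>" "Lam k \<subseteq> T" "card (Lam k) = k"
      and z: "is_arg_min (\<lambda>z. norm (y - A *v z)) (\<lambda>z. block_supp z \<subseteq> Lam k) z" "r k = y - A *v z"
      by auto
    have L: "Lam k \<subset> T" using IH Suc.prems by auto
    have "\<forall>j\<le>k. \<not> norm (r j) \<le> \<epsilon>"
      using IH(1) residual_large[OF L z] by (auto simp: le_less)
    then have step: "is_arg_max (\<lambda>l. norm (transpose (col_block A l) *v r k)) (\<lambda>l. l \<in> UNIV) (lam (Suc k))"
      "Lam (Suc k) = Lam k \<union> {lam (Suc k)}"
      "is_arg_min (\<lambda>z. norm (y - A *v z)) (\<lambda>z. block_supp z \<subseteq> Lam (Suc k)) (xs (Suc k))"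
      "r (Suc k) = y - A *v xs (Suc k)"
      using run unfolding bomp_run_def by blast+
    have max: "norm (transpose (col_block A i) *v r k) \<le> norm (transpose (col_block A (lam (Suc k))) *v r k)" for i
      using step(1) by (simp add: is_arg_max_linorder)
    have "lam (Suc k) \<in> T" "lam (Suc k) \<notin> Lam k"
      using maximizer_in_T[OF L z max] maximizer_not_in_L[OF L z max] by auto
    then show ?case
      using step IH \<open>\<forall>j\<le>k. \<not> norm (r j) \<le> \<epsilon>\<close> by (auto simp: less_Suc_eq_le)
  qed
  obtain z where k: "\<forall>j<card T. \<not> norm (r j) \<le> \<epsilon>" "Lam (card T) \<subseteq> T" "card (Lam (card T)) = card T"
    and z: "is_arg_min (\<lambda>z. norm (y - A *v z)) (\<lambda>z. block_supp z \<subseteq> Lam (card T)) z"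
      "r (card T) = y - A *v z"
    using inv[of "card T"] by auto
  have Lam: "Lam (card T) = T" using k by (intro card_subset_eq) auto
  \<comment> \<open>With the whole of \<open>T\<close> available, the residual is as small as that
    of \<open>w\<close>, so the criterion is met exactly now.\<close>
  have "norm (r (card T)) \<le> norm (y - A *v w)"
    using z w_min unfolding Lam by (auto simp: is_arg_min_linorder)
  then show "\<exists>k\<le>K. (\<forall>j<k. \<not> norm (r j) \<le> \<epsilon>) \<and> norm (r k) \<le> \<epsilon> \<and> Lam k = T"
    using k Lam card_T noise by (intro exI[of _ "card T"]) auto
qed

end

section \<open>From the true signal to its least squares replacement\<close>

theorem theorem1:
  fixes A :: "real ^ ('b::finite \<times> 'd::finite) ^ 'm::finite"
    and x :: "real ^ ('b \<times> 'd)" and y e :: "real ^ 'm"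
    and K :: nat and T :: "'b set" and \<epsilon> \<delta> :: real
  assumes "K \<ge> 1"
    and "y = A *v x + e"
    and "block_sparse K x"
    and "T = block_supp x"
    and "norm e \<le> \<epsilon>"
    and "\<exists>\<delta>'. block_RIP (K + 1) A \<delta>'"
    and "\<delta> = block_RIC (K + 1) A"
    and "\<delta> < 1 / sqrt (real (K + 1))"
    and "(INF i\<in>T. ereal (norm (block x i))) >
           ereal (\<epsilon> / sqrt (1 - \<delta>) + \<epsilon> * sqrt (1 + \<delta>) / (1 - sqrt (real (K + 1)) * \<delta>))"
  shows "bomp_exactly_recovers A y (\<lambda>r. norm r \<le> \<epsilon>) T K"
proof -
  have ex: "\<exists>\<delta>'. block_RIP (K + 1) A \<delta>'" by fact
  have d0: "0 \<le> \<delta>" using block_RIC_nonneg[OF ex] assms(7) by simp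
  have dK: "sqrt (real (K + 1)) * \<delta> < 1"
    using assms(8) by (simp add: field_simps)
  have "1 * \<delta> \<le> sqrt (real (K + 1)) * \<delta>" by (rule mult_right_mono) (use d0 in auto)
  then have d1: "\<delta> < 1" using dK by simp
  have lower: "(1 - \<delta>) * (norm h)\<^sup>2 \<le> (norm (A *v h))\<^sup>2"
    and upper: "(norm (A *v h))\<^sup>2 \<le> (1 + \<delta>) * (norm h)\<^sup>2" if "block_sparse (K + 1) h" for h
    using block_RIC_bounds[OF ex that] assms(7) by auto
  have card_T: "card T \<le> K" using assms(3,4) by (simp add: block_sparse_def)
  obtain w where w: "is_arg_min (\<lambda>z. norm (y - A *v z)) (\<lambda>z. block_supp z \<subseteq> T) w"
    using block_least_squares_exists by blast
  have noise: "norm (y - A *v w) \<le> \<epsilon>"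
  proof -
    have "norm (y - A *v w) \<le> norm (y - A *v x)"
      using w assms(4) by (auto simp: is_arg_min_linorder)
    then show ?thesis using assms(2,5) by simp
  qed
  have supp: "block_supp (x - w) \<subseteq> T"
    using w assms(4) block_supp_diff[of x w] by (auto simp: is_arg_min_linorder)
  have "(1 - \<delta>) * (norm (x - w))\<^sup>2 \<le> (norm (A *v (x - w)))\<^sup>2"
    using card_T by (intro lower block_sparse_subset[OF supp]) auto
  \<comment> \<open>\<open>e\<close> is the least squares residual minus
    \<open>A *v (x - w)\<close>, and these two are orthogonal.\<close>
  also have "\<dots> \<le> (norm e)\<^sup>2"
  proof -
    have "e = (y - A *v w) - A *v (x - w)"
      using assms(2) by (simp add: matrix_vector_mult_diff_distrib)
    moreover have "(A *v (x - w)) \<bullet> (y - A *v w) = 0"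
      by (rule least_squares_orthogonal[OF w supp])
    ultimately have "(norm e)\<^sup>2 = (norm (y - A *v w))\<^sup>2 + (norm (A *v (x - w)))\<^sup>2"
      by (simp add: power2_norm_eq_inner inner_diff_left inner_diff_right inner_commute)
    then show ?thesis by simp
  qed
  finally have "sqrt (1 - \<delta>) * norm (x - w) \<le> \<epsilon>"
    using real_sqrt_le_mono assms(5) by (fastforce simp: real_sqrt_mult)
  then have close: "norm (x - w) \<le> \<epsilon> / sqrt (1 - \<delta>)"
    using d1 by (simp add: field_simps)
  \<comment> \<open>A block of \<open>w\<close> is shorter than that of \<open>x\<close> by at most
    \<open>norm (x - w)\<close>, which the first term of the hypothesis absorbs.\<close>
  have "\<epsilon> * sqrt (1 + \<delta>) / (1 - sqrt (real (K + 1)) * \<delta>) < norm (block w i)" if "i \<in> T" for i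
  proof -
    have "ereal (\<epsilon> / sqrt (1 - \<delta>) + \<epsilon> * sqrt (1 + \<delta>) / (1 - sqrt (real (K + 1)) * \<delta>))
        < ereal (norm (block x i))"
      using assms(9) INF_lower[OF that] less_le_trans by blast
    moreover have "norm (block x i) \<le> norm (block w i) + norm (x - w)"
      using norm_triangle_ineq[of "block w i" "block (x - w) i"] norm_block_le[of "x - w" i]
      by (simp add: block_diff)
    ultimately show ?thesis using close by simp
  qed
  then show ?thesis
    by (intro bomp_exactly_recovers_support[OF lower upper d0 dK card_T w noise])
qed

end
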